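(* Let $k$ be an algebraically closed field of characteristic $0$ and let $H$ be a finite dimensional Frobenius weak Hopf algebra over $k$. Let $\ell\in\int_H^l$ be a non-degenerate left integral and $\lambda\in\int_{H^*}^l$ its dual left integral (so $\lambda\rightharpoonup\ell=1$ and $\ell\rightharpoonup\lambda=\epsilon$). Then $$\mathrm{Tr}(S^2)=\langle\varepsilon_s(\lambda),\varepsilon_s(\ell)\rangle,$$ where $\mathrm{Tr}(S^2)$ is the trace of the linear map $S^2:H\to H$.
   Context: A weak Hopf algebra over a field $k$ is a $k$-vector space $H$ with an associative unital algebra structure $(m,1)$, a coassociative counital coalgebra structure $(\Delta,\epsilon)$ (Sweedler notation $\Delta(h)=h_{(1)}\otimes h_{(2)}$) and a linear map $S:H\to H$ (antipode) such that for all $f,g,h\in H$: $\Delta(hg)=\Delta(h)\Delta(g)$; $(\Delta\otimes\mathrm{id})\Delta(1)=(\Delta(1)\otimes1)(1\otimes\Delta(1))=(1\otimes\Delta(1))(\Delta(1)\otimes1)$; $\epsilon(fgh)=\epsilon(fg_{(1)})\epsilon(g_{(2)}h)=\epsilon(fg_{(2)})\epsilon(g_{(1)}h)$; $m(\mathrm{id}\otimes S)\Delta(h)=(\epsilon\otimes\mathrm{id})(\Delta(1)(h\otimes1))$; $m(S\otimes\mathrm{id})\Delta(h)=(\mathrm{id}\otimes\epsilon)((1\otimes h)\Delta(1))$; $S(h)=S(h_{(1)})h_{(2)}S(h_{(3)})$. ($\Delta(1)\neq1\otimes1$ in general.) Counital maps of any weak Hopf algebra: $\varepsilon_t(h)=\epsilon(1_{(1)}h)1_{(2)}$,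 $\varepsilon_s(h)=1_{(1)}\epsilon(h1_{(2)})$. If $\dim_kH<\infty$, $H^*$ is a weak Hopf algebra via $\langle\phi\psi,h\rangle=\langle\phi\otimes\psi,\Delta(h)\rangle$, $\langle\Delta(\phi),h\otimes g\rangle=\langle\phi,hg\rangle$, $\langle S(\phi),h\rangle=\langle\phi,S(h)\rangle$, with unit $\epsilon$ and counit $\phi\mapsto\langle\phi,1\rangle$; $\varepsilon_s(\lambda)$ is computed in $H^*$. Arrows: $\phi\rightharpoonup h=h_{(1)}\langle\phi,h_{(2)}\rangle$, $h\rightharpoonup\phi=\phi_{(1)}\langle\phi_{(2)},h\rangle$. A left integral in $H$ is $\ell\in H$ with $h\ell=\varepsilon_t(h)\ell$ for all $h\in H$; $\int_H^l$ is the space of these. It is non-degenerate if it defines a non-degenerate functional on $H^*$. $H$ is Frobenius (as an algebra) if and only if it has a non-degenerate integral; each non-degenerate left integral $\ell$ then has a unique dual $\lambda$ with $\lambda\rightharpoonup\ell=1$, which is a non-degenerate left integral in $H^*$ and satisfies $\ell\rightharpoonup\lambda=\epsilon$. *)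

theory Defs
  imports
    "HOL-Library.Function_Algebras"
    "HOL-Computational_Algebra.Polynomial"
begin

section \<open>Vector spaces on a carrier\<close>

text \<open>
  Spaces and algebras are records with an explicit carrier, a subspace of an ambient vector space
  given by a type. Thus the dual of a weak Hopf algebra, whose elements are the linear functionals,
  is again a record of the same kind, and integrals and counital maps in the dual are literally
  instances of the general notions.
\<close>

record ('k, 'a) vec_sp =
  vcarrier :: "'a set"
  vscale :: "'k \<Rightarrow> 'a \<Rightarrow> 'a"

locale vec_space =
  fixes V :: "('k::field, 'a::ab_group_add, 'm) vec_sp_scheme"
  assumes ambient: "vector_space (vscale V)"
    and subspace: "module.subspace (vscale V) (vcarrier V)"

definition fin_dim :: "('k::field, 'a::ab_group_add, 'm) vec_sp_scheme \<Rightarrow> bool" where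
  "fin_dim V \<longleftrightarrow> (\<exists>B. finite B \<and> module.span (vscale V) B = vcarrier V)"

definition linear_map_on ::
    "('k::field, 'a::ab_group_add, 'm) vec_sp_scheme \<Rightarrow> ('k \<Rightarrow> 'b::ab_group_add \<Rightarrow> 'b) \<Rightarrow> ('a \<Rightarrow> 'b) \<Rightarrow> bool"
  where
  "linear_map_on V s f \<longleftrightarrow>
     (\<forall>x\<in>vcarrier V. \<forall>y\<in>vcarrier V. f (x + y) = f x + f y) \<and>
     (\<forall>c. \<forall>x\<in>vcarrier V. f (vscale V c x) = s c (f x))"

definition bilinear_map_on ::
    "('k::field, 'a::ab_group_add, 'm) vec_sp_scheme \<Rightarrow> ('k \<Rightarrow> 'b::ab_group_add \<Rightarrow> 'b) \<Rightarrow> ('a \<Rightarrow> 'a \<Rightarrow> 'b) \<Rightarrow> bool"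
  where
  "bilinear_map_on V s f \<longleftrightarrow>
     (\<forall>x\<in>vcarrier V. linear_map_on V s (f x)) \<and>
     (\<forall>y\<in>vcarrier V. linear_map_on V s (\<lambda>x. f x y))"

definition trilinear_map_on ::
    "('k::field, 'a::ab_group_add, 'm) vec_sp_scheme \<Rightarrow> ('k \<Rightarrow> 'b::ab_group_add \<Rightarrow> 'b)
      \<Rightarrow> ('a \<Rightarrow> 'a \<Rightarrow> 'a \<Rightarrow> 'b) \<Rightarrow> bool"
  where
  "trilinear_map_on V s f \<longleftrightarrow>
     (\<forall>x\<in>vcarrier V. bilinear_map_on V s (f x)) \<and>
     (\<forall>y\<in>vcarrier V. \<forall>z\<in>vcarrier V. linear_map_on V s (\<lambda>x. f x y z))"

text \<open>The trace of an endomorphism of a finite-dimensional space: the sum of its diagonal matrix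
  coefficients in some (equivalently, any) basis.\<close>

definition endo_trace ::
    "('k::field, 'a::ab_group_add, 'm) vec_sp_scheme \<Rightarrow> ('a \<Rightarrow> 'a) \<Rightarrow> 'k" where
  "endo_trace V f =
     (let B = (SOME B. \<not> module.dependent (vscale V) B \<and> module.span (vscale V) B = vcarrier V)
      in \<Sum>b\<in>B. module.representation (vscale V) B (f b) b)"

section \<open>Tensor powers and Sweedler sums\<close>

text \<open>
  The tensor square of \<open>V\<close> is realised as the span of the pure tensors inside the space of
  functionals on bilinear forms, the pure tensor of \<open>a\<close> and \<open>b\<close> being evaluation at \<open>(a, b)\<close>.
  By the universal property this is the canonical map from the tensor product to its double dual,
  which is injective over a field. The tensor cube is treated in the same way, which makes both
  bracketings literally equal.
\<close>

definition tensor2 ::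
    "('k::field, 'a::ab_group_add, 'm) vec_sp_scheme \<Rightarrow> 'a \<Rightarrow> 'a \<Rightarrow> (('a \<Rightarrow> 'a \<Rightarrow> 'k) \<Rightarrow> 'k)" where
  "tensor2 V a b = (\<lambda>B. if bilinear_map_on V (*) B then B a b else 0)"

definition tensor3 ::
    "('k::field, 'a::ab_group_add, 'm) vec_sp_scheme \<Rightarrow> 'a \<Rightarrow> 'a \<Rightarrow> 'a
      \<Rightarrow> (('a \<Rightarrow> 'a \<Rightarrow> 'a \<Rightarrow> 'k) \<Rightarrow> 'k)" where
  "tensor3 V a b c = (\<lambda>T. if trilinear_map_on V (*) T then T a b c else 0)"

definition tensor_reps ::
    "('k::field, 'a::ab_group_add, 'm) vec_sp_scheme \<Rightarrow> (('a \<Rightarrow> 'a \<Rightarrow> 'k) \<Rightarrow> 'k) \<Rightarrow> ('a \<times> 'a) list set" where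
  "tensor_reps V t =
     {ps. set ps \<subseteq> vcarrier V \<times> vcarrier V \<and> t = (\<Sum>(a, b)\<leftarrow>ps. tensor2 V a b)}"

definition tensor_square ::
    "('k::field, 'a::ab_group_add, 'm) vec_sp_scheme \<Rightarrow> (('a \<Rightarrow> 'a \<Rightarrow> 'k) \<Rightarrow> 'k) set" where
  "tensor_square V = {t. tensor_reps V t \<noteq> {}}"

text \<open>
  The Sweedler sum of \<open>f\<close> over a tensor \<open>t\<close>, i.e. the value at \<open>t\<close> of the linear map induced by the
  bilinear map \<open>f\<close>. The choice of a representation of \<open>t\<close> as a sum of pure tensors is immaterial,
  see \<open>sweedler_eq\<close> below.
\<close>

definition sweedler ::
    "('k::field, 'a::ab_group_add, 'm) vec_sp_scheme \<Rightarrow> (('a \<Rightarrow> 'a \<Rightarrow> 'k) \<Rightarrow> 'k)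
      \<Rightarrow> ('a \<Rightarrow> 'a \<Rightarrow> 'b::comm_monoid_add) \<Rightarrow> 'b" where
  "sweedler V t f = (\<Sum>(a, b)\<leftarrow>(SOME ps. ps \<in> tensor_reps V t). f a b)"

lemma tensor_rep_eval:
  assumes "ps \<in> tensor_reps V t" and "bilinear_map_on V (*) B"
  shows "t B = (\<Sum>(a, b)\<leftarrow>ps. B a b)"
proof -
  have "(\<Sum>(a, b)\<leftarrow>qs. tensor2 V a b) B = (\<Sum>(a, b)\<leftarrow>qs. B a b)" for qs
    using assms(2) by (induction qs) (auto simp: tensor2_def)
  then show ?thesis
    using assms(1) by (simp add: tensor_reps_def)
qed

lemma sweedler_eq:
  fixes s :: "'k::field \<Rightarrow> 'b::ab_group_add \<Rightarrow> 'b"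
  assumes s: "vector_space s" and f: "bilinear_map_on V s f" and ps: "ps \<in> tensor_reps V t"
  shows "sweedler V t f = (\<Sum>(a, b)\<leftarrow>ps. f a b)"
proof (rule ccontr)
  interpret W: vector_space s by fact
  interpret K: vector_space "(*) :: 'k \<Rightarrow> 'k \<Rightarrow> 'k"
    by unfold_locales (auto simp: algebra_simps)
  interpret WK: vector_space_pair s "(*) :: 'k \<Rightarrow> 'k \<Rightarrow> 'k" ..
  define qs where "qs = (SOME ps. ps \<in> tensor_reps V t)"
  have qs: "qs \<in> tensor_reps V t"
    unfolding qs_def using ps by (rule someI)
  define d where "d = sweedler V t f - (\<Sum>(a, b)\<leftarrow>ps. f a b)"
  assume "sweedler V t f \<noteq> (\<Sum>(a, b)\<leftarrow>ps. f a b)"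
  then have "d \<noteq> 0" by (simp add: d_def)
  then have ind: "W.independent {d}" by simp
  define g where "g = WK.construct {d} (\<lambda>_. 1)"
  have lin: "Vector_Spaces.linear s (*) g"
    unfolding g_def by (rule WK.linear_construct[OF ind])
  then interpret g: Vector_Spaces.linear s "(*)" g .
  have "g d = 1"
    unfolding g_def by (rule WK.construct_basis[OF ind]) simp
  have B: "bilinear_map_on V (*) (\<lambda>a b. g (f a b))"
    using f unfolding bilinear_map_on_def linear_map_on_def by (auto simp: g.add g.scale)
  have sum: "g (\<Sum>(a, b)\<leftarrow>rs. f a b) = (\<Sum>(a, b)\<leftarrow>rs. g (f a b))" for rs
    by (induction rs) (auto simp: g.add g.zero)
  have "g (sweedler V t f) = g (\<Sum>(a, b)\<leftarrow>ps. f a b)"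
    unfolding sweedler_def qs_def[symmetric] sum
    using tensor_rep_eval[OF ps B] tensor_rep_eval[OF qs B] by simp
  then have "g d = 0" by (simp add: d_def g.diff)
  with \<open>g d = 1\<close> show False by simp
qed

section \<open>Weak Hopf algebras\<close>

record ('k, 'a) weak_hopf_data = "('k, 'a) vec_sp" +
  hmult :: "'a \<Rightarrow> 'a \<Rightarrow> 'a"
  hone :: "'a"
  hcomult :: "'a \<Rightarrow> (('a \<Rightarrow> 'a \<Rightarrow> 'k) \<Rightarrow> 'k)"
  hcounit :: "'a \<Rightarrow> 'k"
  hantipode :: "'a \<Rightarrow> 'a"

locale unital_algebra = vec_space H
  for H :: "('k::field, 'a::ab_group_add, 'm) weak_hopf_data_scheme" +
  assumes mult_closed: "\<lbrakk>f \<in> vcarrier H; g \<in> vcarrier H\<rbrakk> \<Longrightarrow> hmult H f g \<in> vcarrier H"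
    and one_closed: "hone H \<in> vcarrier H"
    and mult_bilinear: "bilinear_map_on H (vscale H) (hmult H)"
    and mult_assoc: "\<lbrakk>f \<in> vcarrier H; g \<in> vcarrier H; h \<in> vcarrier H\<rbrakk>
      \<Longrightarrow> hmult H (hmult H f g) h = hmult H f (hmult H g h)"
    and mult_one_left: "h \<in> vcarrier H \<Longrightarrow> hmult H (hone H) h = h"
    and mult_one_right: "h \<in> vcarrier H \<Longrightarrow> hmult H h (hone H) = h"

locale counital_coalgebra = vec_space H
  for H :: "('k::field, 'a::ab_group_add, 'm) weak_hopf_data_scheme" +
  assumes comult_closed: "h \<in> vcarrier H \<Longrightarrow> hcomult H h \<in> tensor_square H"
    and comult_linear: "linear_map_on H (\<lambda>c t B. c * t B) (hcomult H)"
    and counit_linear: "linear_map_on H (*) (hcounit H)"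
    and coassoc: "h \<in> vcarrier H \<Longrightarrow>
      sweedler H (hcomult H h) (\<lambda>a b. sweedler H (hcomult H a) (\<lambda>c d. tensor3 H c d b)) =
      sweedler H (hcomult H h) (\<lambda>a b. sweedler H (hcomult H b) (\<lambda>c d. tensor3 H a c d))"
    and counit_left: "h \<in> vcarrier H \<Longrightarrow>
      sweedler H (hcomult H h) (\<lambda>a b. vscale H (hcounit H a) b) = h"
    and counit_right: "h \<in> vcarrier H \<Longrightarrow>
      sweedler H (hcomult H h) (\<lambda>a b. vscale H (hcounit H b) a) = h"

definition eps_t :: "('k::field, 'a::ab_group_add, 'm) weak_hopf_data_scheme \<Rightarrow> 'a \<Rightarrow> 'a" where
  "eps_t H h = sweedler H (hcomult H (hone H)) (\<lambda>a b. vscale H (hcounit H (hmult H a h)) b)"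

definition eps_s :: "('k::field, 'a::ab_group_add, 'm) weak_hopf_data_scheme \<Rightarrow> 'a \<Rightarrow> 'a" where
  "eps_s H h = sweedler H (hcomult H (hone H)) (\<lambda>a b. vscale H (hcounit H (hmult H h b)) a)"

locale weak_hopf_algebra = unital_algebra H + counital_coalgebra H
  for H :: "('k::field, 'a::ab_group_add, 'm) weak_hopf_data_scheme" +
  assumes antipode_closed: "h \<in> vcarrier H \<Longrightarrow> hantipode H h \<in> vcarrier H"
    and antipode_linear: "linear_map_on H (vscale H) (hantipode H)"
    and comult_mult: "\<lbrakk>h \<in> vcarrier H; g \<in> vcarrier H\<rbrakk> \<Longrightarrow>
      hcomult H (hmult H h g) =
      sweedler H (hcomult H h) (\<lambda>a b. sweedler H (hcomult H g) (\<lambda>c d.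
        tensor2 H (hmult H a c) (hmult H b d)))"
    and comult_one_1:
      "sweedler H (hcomult H (hone H)) (\<lambda>a b. sweedler H (hcomult H a) (\<lambda>c d. tensor3 H c d b)) =
       sweedler H (hcomult H (hone H)) (\<lambda>a b. sweedler H (hcomult H (hone H)) (\<lambda>c d.
         tensor3 H (hmult H a (hone H)) (hmult H b c) (hmult H (hone H) d)))"
    and comult_one_2:
      "sweedler H (hcomult H (hone H)) (\<lambda>a b. sweedler H (hcomult H a) (\<lambda>c d. tensor3 H c d b)) =
       sweedler H (hcomult H (hone H)) (\<lambda>c d. sweedler H (hcomult H (hone H)) (\<lambda>a b.
         tensor3 H (hmult H (hone H) a) (hmult H c b) (hmult H d (hone H))))"
    and counit_mult_1: "\<lbrakk>f \<in> vcarrier H; g \<in> vcarrier H; h \<in> vcarrier H\<rbrakk> \<Longrightarrow>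
      hcounit H (hmult H (hmult H f g) h) =
      sweedler H (hcomult H g) (\<lambda>a b. hcounit H (hmult H f a) * hcounit H (hmult H b h))"
    and counit_mult_2: "\<lbrakk>f \<in> vcarrier H; g \<in> vcarrier H; h \<in> vcarrier H\<rbrakk> \<Longrightarrow>
      hcounit H (hmult H (hmult H f g) h) =
      sweedler H (hcomult H g) (\<lambda>a b. hcounit H (hmult H f b) * hcounit H (hmult H a h))"
    and antipode_right: "h \<in> vcarrier H \<Longrightarrow>
      sweedler H (hcomult H h) (\<lambda>a b. hmult H a (hantipode H b)) = eps_t H h"
    and antipode_left: "h \<in> vcarrier H \<Longrightarrow>
      sweedler H (hcomult H h) (\<lambda>a b. hmult H (hantipode H a) b) = eps_s H h"
    and antipode_antipode: "h \<in> vcarrier H \<Longrightarrow>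
      hantipode H h = sweedler H (hcomult H h) (\<lambda>a b. sweedler H (hcomult H a) (\<lambda>c d.
        hmult H (hmult H (hantipode H c) d) (hantipode H b)))"

section \<open>The dual weak Hopf algebra\<close>

text \<open>A functional on the carrier is represented by its extension by zero to the ambient type, so
  that equality of functionals is equality of functions. All operations below respect this.\<close>

definition dual_space ::
    "('k::field, 'a::ab_group_add, 'm) vec_sp_scheme \<Rightarrow> ('k, 'a \<Rightarrow> 'k) vec_sp" where
  "dual_space V =
     \<lparr>vcarrier = {\<phi>. linear_map_on V (*) \<phi> \<and> (\<forall>x. x \<notin> vcarrier V \<longrightarrow> \<phi> x = 0)},
      vscale = (\<lambda>c \<phi> x. c * \<phi> x)\<rparr>"

text \<open>The coproduct of \<open>\<phi>\<close> is the unique tensor over the dual that pairs with \<open>h \<otimes> g\<close> to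
  \<open>\<phi> (h g)\<close>; it exists when \<open>H\<close> is finite-dimensional.\<close>

definition dual ::
    "('k::field, 'a::ab_group_add, 'm) weak_hopf_data_scheme \<Rightarrow> ('k, 'a \<Rightarrow> 'k) weak_hopf_data" where
  "dual H =
     \<lparr>vcarrier = vcarrier (dual_space H),
      vscale = vscale (dual_space H),
      hmult = (\<lambda>\<phi> \<psi> h. if h \<in> vcarrier H then sweedler H (hcomult H h) (\<lambda>a b. \<phi> a * \<psi> b) else 0),
      hone = (\<lambda>h. if h \<in> vcarrier H then hcounit H h else 0),
      hcomult = (\<lambda>\<phi>. THE t. t \<in> tensor_square (dual_space H) \<and>
        (\<forall>h\<in>vcarrier H. \<forall>g\<in>vcarrier H.
          sweedler (dual_space H) t (\<lambda>\<alpha> \<beta>. \<alpha> h * \<beta> g) = \<phi> (hmult H h g))),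
      hcounit = (\<lambda>\<phi>. \<phi> (hone H)),
      hantipode = (\<lambda>\<phi> h. if h \<in> vcarrier H then \<phi> (hantipode H h) else 0)\<rparr>"

definition harpoon ::
    "('k::field, 'a::ab_group_add, 'm) weak_hopf_data_scheme \<Rightarrow> ('a \<Rightarrow> 'k) \<Rightarrow> 'a \<Rightarrow> 'a" where
  "harpoon H \<phi> h = sweedler H (hcomult H h) (\<lambda>a b. vscale H (\<phi> b) a)"

section \<open>Integrals and the Frobenius property\<close>

definition left_integrals ::
    "('k::field, 'a::ab_group_add, 'm) weak_hopf_data_scheme \<Rightarrow> 'a set" where
  "left_integrals H =
     {l \<in> vcarrier H. \<forall>h\<in>vcarrier H. hmult H h l = hmult H (eps_t H h) l}"

definition nondegenerate_functional ::
    "('k::field, 'a::ab_group_add, 'm) weak_hopf_data_scheme \<Rightarrow> ('a \<Rightarrow> 'k) \<Rightarrow> bool" where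
  "nondegenerate_functional A F \<longleftrightarrow>
     linear_map_on A (*) F \<and>
     (\<forall>a\<in>vcarrier A. (\<forall>b\<in>vcarrier A. F (hmult A a b) = 0) \<longrightarrow> a = 0) \<and>
     (\<forall>b\<in>vcarrier A. (\<forall>a\<in>vcarrier A. F (hmult A a b) = 0) \<longrightarrow> b = 0)"

definition frobenius_algebra ::
    "('k::field, 'a::ab_group_add, 'm) weak_hopf_data_scheme \<Rightarrow> bool" where
  "frobenius_algebra A \<longleftrightarrow>
     unital_algebra A \<and> fin_dim A \<and> (\<exists>F. nondegenerate_functional A F)"

definition nondegenerate_element ::
    "('k::field, 'a::ab_group_add, 'm) weak_hopf_data_scheme \<Rightarrow> 'a \<Rightarrow> bool" where
  "nondegenerate_element H l \<longleftrightarrow> nondegenerate_functional (dual H) (\<lambda>\<phi>. \<phi> l)"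

end

theory Submission
  imports Defs
begin

text \<open>Both sides of the trace formula equal \<open>\<langle>\<lambda>, \<epsilon>\<^sub>s(\<ell>)\<rangle>\<close>.

  For the trace, the key is that a left integral satisfies
  \<open>\<ell>\<^sub>1 \<otimes> h\<ell>\<^sub>2 = S(h)\<ell>\<^sub>1 \<otimes> \<ell>\<^sub>2\<close> (\<open>left_integral_antipode\<close>). Applying \<open>\<lambda>\<close> to the second leg and using
  \<open>\<lambda> \<rightharpoonup> \<ell> = 1\<close> gives \<open>S(h) = \<lambda>(h\<ell>\<^sub>2) \<ell>\<^sub>1\<close>, hence \<open>S\<^sup>2(h) = \<lambda>(h\<ell>\<^sub>2) S(\<ell>\<^sub>1)\<close>. This exhibits \<open>S\<^sup>2\<close> as
  the sum of the rank-one maps \<open>\<lambda>(- \<ell>\<^sub>2) \<otimes> S(\<ell>\<^sub>1)\<close>, and evaluating each functional at its vector gives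
  \<open>Tr(S\<^sup>2) = \<lambda>(S(\<ell>\<^sub>1)\<ell>\<^sub>2) = \<lambda>(\<epsilon>\<^sub>s(\<ell>))\<close> (\<open>trace_antipode_square\<close>).

  The identity for integrals comes from computing \<open>S(h\<^sub>1)(h\<^sub>2\<ell>)\<^sub>1 \<otimes> (h\<^sub>2\<ell>)\<^sub>2\<close> twice. As \<open>\<Delta>\<close> is
  multiplicative it is \<open>\<epsilon>\<^sub>s(h\<^sub>1)\<ell>\<^sub>1 \<otimes> h\<^sub>2\<ell>\<^sub>2\<close>, and \<open>\<epsilon>\<^sub>s(h\<^sub>1) \<otimes> h\<^sub>2 = 1\<^sub>1 \<otimes> h1\<^sub>2\<close> turns this into
  \<open>\<ell>\<^sub>1 \<otimes> h\<ell>\<^sub>2\<close>. As \<open>\<ell>\<close> is an integral, \<open>h\<^sub>2\<ell> = \<epsilon>\<^sub>t(h\<^sub>2)\<ell>\<close>, and since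
  \<open>\<Delta>(\<epsilon>\<^sub>t(x)\<ell>) = \<epsilon>\<^sub>t(x)\<ell>\<^sub>1 \<otimes> \<ell>\<^sub>2\<close> and \<open>S(h\<^sub>1)\<epsilon>\<^sub>t(h\<^sub>2) = S(h)\<close>, it is also \<open>S(h)\<ell>\<^sub>1 \<otimes> \<ell>\<^sub>2\<close>.

  On the other side, the unit of \<open>H\<^sup>*\<close> is \<open>\<epsilon>\<close>, whose coproduct corresponds to the form \<open>(h, g) \<mapsto> \<epsilon>(hg)\<close>. Unfolding
  \<open>\<epsilon>\<^sub>s\<close> in \<open>H\<^sup>*\<close> gives \<open>\<langle>\<epsilon>\<^sub>s(\<lambda>), z\<rangle> = \<lambda>(1\<^sub>1) \<epsilon>(z1\<^sub>2)\<close> (\<open>dual_eps_s\<close>); at \<open>z = \<epsilon>\<^sub>s(\<ell>)\<close> the weak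
  multiplicativity of the counit replaces \<open>\<epsilon>(\<epsilon>\<^sub>s(\<ell>)1\<^sub>2)\<close> by \<open>\<epsilon>(\<ell>1\<^sub>2)\<close>, which leaves \<open>\<lambda>(\<epsilon>\<^sub>s(\<ell>))\<close>.\<close>

section \<open>Sweedler sums\<close>

lemma sum_list_fun_apply: "(\<Sum>p\<leftarrow>ps. F p) x = (\<Sum>p\<leftarrow>ps. F p x)"
  for F :: "'a \<Rightarrow> 'b \<Rightarrow> 'c::comm_monoid_add"
  by (induction ps) auto

lemma sum_fun_apply: "(\<Sum>i\<in>I. F i) x = (\<Sum>i\<in>I. F i x)"
  for F :: "'i \<Rightarrow> 'b \<Rightarrow> 'c::comm_monoid_add"
  by (induction I rule: infinite_finite_induct) auto

lemma sweedler_eval: "sweedler V t f x = sweedler V t (\<lambda>a b. f a b x)"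
  unfolding sweedler_def split_def by (rule sum_list_fun_apply)

lemma sweedler_add:
  "sweedler V t (\<lambda>a b. f a b + g a b) = sweedler V t f + sweedler V t g"
  unfolding sweedler_def by (simp add: split_def sum_list_addf)

lemma sweedler_mult_left: "sweedler V t (\<lambda>a b. c * f a b) = c * sweedler V t f"
  for c :: "'k::field"
  unfolding sweedler_def by (simp add: split_def sum_list_const_mult)

lemma sweedler_mult_right: "sweedler V t (\<lambda>a b. f a b * c) = sweedler V t f * c"
  for c :: "'k::field"
  unfolding sweedler_def by (simp add: split_def sum_list_mult_const)

lemma sweedler_sum:
  "sweedler V t (\<lambda>a b. \<Sum>i\<in>I. f i a b) = (\<Sum>i\<in>I. sweedler V t (f i))"
  unfolding sweedler_def split_def
  by (induction I rule: infinite_finite_induct) (auto simp: sum_list_addf)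

lemma sweedler_swap:
  "sweedler V t (\<lambda>a b. sweedler W u (\<lambda>c d. F a b c d)) =
   sweedler W u (\<lambda>c d. sweedler V t (\<lambda>a b. F a b c d))"
proof -
  have "(\<Sum>p\<leftarrow>ps. \<Sum>q\<leftarrow>qs. G p q) = (\<Sum>q\<leftarrow>qs. \<Sum>p\<leftarrow>ps. G p q)"
    for ps qs and G :: "_ \<Rightarrow> _ \<Rightarrow> 'x::comm_monoid_add"
    by (induction ps) (auto simp: sum_list_addf)
  then show ?thesis unfolding sweedler_def split_def .
qed

lemma sweedler_rep_in:
  assumes "t \<in> tensor_square V"
  shows "(SOME ps. ps \<in> tensor_reps V t) \<in> tensor_reps V t"
  using assms unfolding tensor_square_def by (auto simp: some_in_eq)

lemma sweedler_cong:
  assumes "t \<in> tensor_square V"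
    and "\<And>a b. a \<in> vcarrier V \<Longrightarrow> b \<in> vcarrier V \<Longrightarrow> f a b = g a b"
  shows "sweedler V t f = sweedler V t g"
  unfolding sweedler_def
  by (rule arg_cong[where f=sum_list], rule map_cong[OF refl])
     (use sweedler_rep_in[OF assms(1)] assms(2) in \<open>auto simp: tensor_reps_def\<close>)

lemma sweedler_bilinear:
  assumes "t \<in> tensor_square V" and "bilinear_map_on V (*) B"
  shows "sweedler V t B = t B"
  unfolding sweedler_def
  using tensor_rep_eval[OF sweedler_rep_in[OF assms(1)] assms(2)] by simp

lemma linear_map_onI:
  assumes "\<And>x y. \<lbrakk>x \<in> vcarrier V; y \<in> vcarrier V\<rbrakk> \<Longrightarrow> f (x + y) = f x + f y"
    and "\<And>c x. x \<in> vcarrier V \<Longrightarrow> f (vscale V c x) = s c (f x)"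
  shows "linear_map_on V s f"
  using assms by (simp add: linear_map_on_def)

context vec_space
begin

sublocale amb: vector_space "vscale V" by (rule ambient)

lemma carrier_zero [simp]: "0 \<in> vcarrier V"
  and carrier_add [simp]: "\<lbrakk>x \<in> vcarrier V; y \<in> vcarrier V\<rbrakk> \<Longrightarrow> x + y \<in> vcarrier V"
  and carrier_scale [simp]: "x \<in> vcarrier V \<Longrightarrow> vscale V c x \<in> vcarrier V"
  using subspace amb.subspace_0 amb.subspace_add amb.subspace_scale by blast+

lemma linear_map_on_sum_list:
  assumes "linear_map_on V (*) F" and "\<And>p. p \<in> set ps \<Longrightarrow> f p \<in> vcarrier V"
  shows "F (\<Sum>p\<leftarrow>ps. f p) = (\<Sum>p\<leftarrow>ps. F (f p)) \<and> (\<Sum>p\<leftarrow>ps. f p) \<in> vcarrier V"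
  using assms(2)
proof (induction ps)
  case Nil
  have "F (vscale V 0 0) = 0 * F 0"
    using assms(1) carrier_zero unfolding linear_map_on_def by blast
  then show ?case by simp
next
  case (Cons p ps)
  then show ?case using assms(1) unfolding linear_map_on_def by simp
qed

lemma sweedler_linear:
  assumes "linear_map_on V (*) F" and "t \<in> tensor_square V"
    and "\<And>a b. a \<in> vcarrier V \<Longrightarrow> b \<in> vcarrier V \<Longrightarrow> f a b \<in> vcarrier V"
  shows "F (sweedler V t f) = sweedler V t (\<lambda>a b. F (f a b))"
  unfolding sweedler_def split_def
  using linear_map_on_sum_list[OF assms(1), of "SOME ps. ps \<in> tensor_reps V t" "\<lambda>p. f (fst p) (snd p)"]
    sweedler_rep_in[OF assms(2)] assms(3)
  by (force simp: tensor_reps_def)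

lemma sweedler_closed:
  assumes "t \<in> tensor_square V"
    and "\<And>a b. a \<in> vcarrier V \<Longrightarrow> b \<in> vcarrier V \<Longrightarrow> f a b \<in> vcarrier V"
  shows "sweedler V t f \<in> vcarrier V"
proof -
  have "linear_map_on V (*) (\<lambda>_. 0)" by (simp add: linear_map_on_def)
  then show ?thesis
    unfolding sweedler_def split_def
    using linear_map_on_sum_list[of "\<lambda>_. 0" "SOME ps. ps \<in> tensor_reps V t" "\<lambda>p. f (fst p) (snd p)"]
      sweedler_rep_in[OF assms(1)] assms(2)
    by (force simp: tensor_reps_def)
qed

end

section \<open>Traces\<close>

context vec_space
begin

definition finite_basis where
  "finite_basis B \<longleftrightarrow> finite B \<and> amb.independent B \<and> amb.span B = vcarrier V"

lemma endo_trace_basis: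
  assumes "fin_dim V"
  obtains B where "finite_basis B" "endo_trace V f = (\<Sum>b\<in>B. amb.representation B (f b) b)"
proof -
  obtain B0 where B0: "finite B0" "amb.span B0 = vcarrier V"
    using assms unfolding fin_dim_def by blast
  define B where "B = (SOME B. \<not> amb.dependent B \<and> amb.span B = vcarrier V)"
  have "\<exists>B. \<not> amb.dependent B \<and> amb.span B = vcarrier V"
    using amb.basis_exists[of "vcarrier V"] subspace amb.span_minimal
    by (metis subset_antisym)
  then have B: "amb.independent B \<and> amb.span B = vcarrier V"
    unfolding B_def by (rule someI_ex)
  then have "finite B"
    using amb.independent_span_bound[OF B0(1), of B] B0(2) amb.span_superset by blast
  then show ?thesis
    using that[of B] B by (simp add: finite_basis_def endo_trace_def B_def[symmetric])
qed

lemma finite_basis_in: "finite_basis B \<Longrightarrow> b \<in> B \<Longrightarrow> b \<in> vcarrier V"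
  using amb.span_base unfolding finite_basis_def by blast

lemma linear_representation:
  "finite_basis B \<Longrightarrow> linear_map_on V (*) (\<lambda>x. amb.representation B x b)"
  by (intro linear_map_onI) (auto simp: finite_basis_def amb.representation_add amb.representation_scale)

lemma linear_expand:
  assumes B: "finite_basis B" and F: "linear_map_on V (*) F" and x: "x \<in> vcarrier V"
  shows "F x = (\<Sum>b\<in>B. amb.representation B x b * F b)"
proof -
  have "(\<Sum>b\<in>A. c b * F b) = F (\<Sum>b\<in>A. vscale V (c b) b) \<and> (\<Sum>b\<in>A. vscale V (c b) b) \<in> vcarrier V"
    if "finite A" "A \<subseteq> vcarrier V" for A c
    using that
  proof (induction A rule: finite_induct)
    case empty
    have "F (vscale V 0 0) = 0 * F 0"
      using F carrier_zero unfolding linear_map_on_def by blast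
    then show ?case by simp
  next
    case (insert a A)
    then show ?case using F unfolding linear_map_on_def by simp
  qed
  from this[of B "amb.representation B x"]
  have "(\<Sum>b\<in>B. amb.representation B x b * F b) = F (\<Sum>b\<in>B. vscale V (amb.representation B x b) b)"
    using B finite_basis_in by (auto simp: finite_basis_def)
  then show ?thesis
    using amb.sum_representation_eq[of B x B] B x by (simp add: finite_basis_def)
qed

text \<open>The trace of a sum of rank-one maps \<open>h \<mapsto> G(h) u\<close> is the sum of the values \<open>G(u)\<close>. The decomposition of
  \<open>f\<close> is assumed only after applying linear functionals \<open>F\<close>, which suffices because the diagonal
  coefficients are values of such functionals.\<close>

lemma endo_trace_sweedler:
  assumes fd: "fin_dim V" and t: "t \<in> tensor_square V"
    and G: "\<And>x y. \<lbrakk>x \<in> vcarrier V; y \<in> vcarrier V\<rbrakk> \<Longrightarrow> linear_map_on V (*) (G x y)"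
    and u: "\<And>x y. \<lbrakk>x \<in> vcarrier V; y \<in> vcarrier V\<rbrakk> \<Longrightarrow> u x y \<in> vcarrier V"
    and f: "\<And>F h. \<lbrakk>linear_map_on V (*) F; h \<in> vcarrier V\<rbrakk>
      \<Longrightarrow> F (f h) = sweedler V t (\<lambda>x y. G x y h * F (u x y))"
  shows "endo_trace V f = sweedler V t (\<lambda>x y. G x y (u x y))"
proof -
  obtain B where B: "finite_basis B"
    and tr: "endo_trace V f = (\<Sum>b\<in>B. amb.representation B (f b) b)"
    by (rule endo_trace_basis[OF fd])
  have "endo_trace V f = (\<Sum>b\<in>B. sweedler V t (\<lambda>x y. G x y b * amb.representation B (u x y) b))"
    unfolding tr using f[OF linear_representation[OF B]] finite_basis_in[OF B] by simp
  also have "\<dots> = sweedler V t (\<lambda>x y. G x y (u x y))"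
    unfolding sweedler_sum[symmetric]
    by (rule sweedler_cong[OF t]) (use linear_expand[OF B G u] in \<open>simp add: mult.commute\<close>)
  finally show ?thesis .
qed

end

section \<open>Weak Hopf algebra identities tested on multilinear forms\<close>

text \<open>An equation between tensors over \<open>H\<close> is expressed by evaluating both sides at every bilinear or
  trilinear form with values in the field. For such a form, \<open>Delta h (\<lambda>a b. B a b)\<close>
  is read \<open>B(h\<^sub>1, h\<^sub>2)\<close>; these values for all \<open>B\<close> determine \<open>\<Delta>(h)\<close>, and as
  scalar sums they commute with other Sweedler sums and with scalar factors.\<close>

context weak_hopf_algebra
begin

abbreviation carr where "carr \<equiv> vcarrier H"
abbreviation mul (infixl "\<bullet>" 70) where "x \<bullet> y \<equiv> hmult H x y"
abbreviation unit ("\<one>") where "\<one> \<equiv> hone H"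
abbreviation counit ("\<epsilon>") where "\<epsilon> \<equiv> hcounit H"
abbreviation antipode ("\<S>") where "\<S> \<equiv> hantipode H"
abbreviation scale (infixr "\<odot>" 75) where "c \<odot> x \<equiv> vscale H c x"
abbreviation Delta where "Delta h f \<equiv> sweedler H (hcomult H h) f"
abbreviation lin where "lin \<equiv> linear_map_on H ((*) :: 'k \<Rightarrow> 'k \<Rightarrow> 'k)"
abbreviation bil where "bil \<equiv> bilinear_map_on H ((*) :: 'k \<Rightarrow> 'k \<Rightarrow> 'k)"
abbreviation tri where "tri \<equiv> trilinear_map_on H ((*) :: 'k \<Rightarrow> 'k \<Rightarrow> 'k)"

lemmas [simp] = mult_closed one_closed antipode_closed mult_one_left mult_one_right

lemma bilD:
  assumes "bil B"
  shows "\<lbrakk>x \<in> carr; y \<in> carr; z \<in> carr\<rbrakk> \<Longrightarrow> B (x + y) z = B x z + B y z"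
    and "\<lbrakk>x \<in> carr; y \<in> carr; z \<in> carr\<rbrakk> \<Longrightarrow> B z (x + y) = B z x + B z y"
    and "\<lbrakk>x \<in> carr; z \<in> carr\<rbrakk> \<Longrightarrow> B (c \<odot> x) z = c * B x z"
    and "\<lbrakk>x \<in> carr; z \<in> carr\<rbrakk> \<Longrightarrow> B z (c \<odot> x) = c * B z x"
  using assms by (simp_all add: bilinear_map_on_def linear_map_on_def)

lemma linD:
  assumes "lin F"
  shows "\<lbrakk>x \<in> carr; y \<in> carr\<rbrakk> \<Longrightarrow> F (x + y) = F x + F y"
    and "x \<in> carr \<Longrightarrow> F (c \<odot> x) = c * F x"
  using assms by (simp_all add: linear_map_on_def)

lemma bilI:
  assumes "\<And>x y z. \<lbrakk>x \<in> carr; y \<in> carr; z \<in> carr\<rbrakk> \<Longrightarrow> B (x + y) z = B x z + B y z"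
    and "\<And>x y z. \<lbrakk>x \<in> carr; y \<in> carr; z \<in> carr\<rbrakk> \<Longrightarrow> B z (x + y) = B z x + B z y"
    and "\<And>c x z. \<lbrakk>x \<in> carr; z \<in> carr\<rbrakk> \<Longrightarrow> B (c \<odot> x) z = c * B x z"
    and "\<And>c x z. \<lbrakk>x \<in> carr; z \<in> carr\<rbrakk> \<Longrightarrow> B z (c \<odot> x) = c * B z x"
  shows "bil B"
  using assms by (simp add: bilinear_map_on_def linear_map_on_def)

lemma triI:
  assumes "\<And>x. x \<in> carr \<Longrightarrow> bil (T x)"
    and "\<And>x x' y z. \<lbrakk>x \<in> carr; x' \<in> carr; y \<in> carr; z \<in> carr\<rbrakk> \<Longrightarrow> T (x + x') y z = T x y z + T x' y z"
    and "\<And>c x y z. \<lbrakk>x \<in> carr; y \<in> carr; z \<in> carr\<rbrakk> \<Longrightarrow> T (c \<odot> x) y z = c * T x y z"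
  shows "tri T"
  using assms by (simp add: trilinear_map_on_def linear_map_on_def)

lemma structure_linear [simp]:
  shows "\<lbrakk>x \<in> carr; y \<in> carr; z \<in> carr\<rbrakk> \<Longrightarrow> (x + y) \<bullet> z = x \<bullet> z + y \<bullet> z"
    and "\<lbrakk>x \<in> carr; y \<in> carr; z \<in> carr\<rbrakk> \<Longrightarrow> z \<bullet> (x + y) = z \<bullet> x + z \<bullet> y"
    and "\<lbrakk>x \<in> carr; z \<in> carr\<rbrakk> \<Longrightarrow> (c \<odot> x) \<bullet> z = c \<odot> (x \<bullet> z)"
    and "\<lbrakk>x \<in> carr; z \<in> carr\<rbrakk> \<Longrightarrow> z \<bullet> (c \<odot> x) = c \<odot> (z \<bullet> x)"
    and "\<lbrakk>x \<in> carr; y \<in> carr\<rbrakk> \<Longrightarrow> \<epsilon> (x + y) = \<epsilon> x + \<epsilon> y"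
    and "x \<in> carr \<Longrightarrow> \<epsilon> (c \<odot> x) = c * \<epsilon> x"
    and "\<lbrakk>x \<in> carr; y \<in> carr\<rbrakk> \<Longrightarrow> \<S> (x + y) = \<S> x + \<S> y"
    and "x \<in> carr \<Longrightarrow> \<S> (c \<odot> x) = c \<odot> \<S> x"
  using mult_bilinear counit_linear antipode_linear
  by (simp_all add: bilinear_map_on_def linear_map_on_def)

text \<open>As a congruence rule, this makes the membership of the Sweedler components in the carrier available
  when the simplifier rewrites a summand, where the linearity and associativity laws need it.\<close>

lemma Delta_cong [cong]:
  assumes "h = h'" and "h' \<in> carr" and "\<And>a b. a \<in> carr \<Longrightarrow> b \<in> carr \<Longrightarrow> f a b = g a b"
  shows "Delta h f = Delta h' g"
  using assms comult_closed sweedler_cong by metis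

lemma eps_closed [simp]:
  assumes "x \<in> carr"
  shows "eps_s H x \<in> carr" "eps_t H x \<in> carr"
  unfolding eps_s_def eps_t_def using assms
  by (auto intro!: sweedler_closed comult_closed)

lemma Delta_linear:
  assumes "lin F" "h \<in> carr" "\<And>a b. a \<in> carr \<Longrightarrow> b \<in> carr \<Longrightarrow> f a b \<in> carr"
  shows "F (Delta h f) = Delta h (\<lambda>a b. F (f a b))"
  using assms sweedler_linear comult_closed by blast

lemma Delta_eq_comult:
  assumes "h \<in> carr" "bil B"
  shows "Delta h B = hcomult H h B"
  using assms comult_closed sweedler_bilinear by blast

lemma Delta_additive:
  assumes "bil B" "x \<in> carr" "y \<in> carr"
  shows "Delta (x + y) B = Delta x B + Delta y B"
  using comult_linear assms by (simp add: Delta_eq_comult linear_map_on_def)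

lemma Delta_scale:
  assumes "bil B" "x \<in> carr"
  shows "Delta (c \<odot> x) B = c * Delta x B"
  using comult_linear assms by (simp add: Delta_eq_comult linear_map_on_def)

lemma Delta_mult:
  assumes "bil B" "h \<in> carr" "g \<in> carr"
  shows "Delta (h \<bullet> g) B = Delta h (\<lambda>a b. Delta g (\<lambda>c d. B (a \<bullet> c) (b \<bullet> d)))"
  using assms by (simp add: Delta_eq_comult comult_mult sweedler_eval tensor2_def)

lemma Delta_coassoc:
  assumes "tri T" "h \<in> carr"
  shows "Delta h (\<lambda>a b. Delta a (\<lambda>c d. T c d b)) = Delta h (\<lambda>a b. Delta b (\<lambda>c d. T a c d))"
  using fun_cong[OF coassoc[OF assms(2)], of T] assms
  by (simp add: sweedler_eval tensor3_def)

lemma Delta_one_1: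
  assumes "tri T"
  shows "Delta \<one> (\<lambda>a b. Delta b (\<lambda>c d. T a c d)) = Delta \<one> (\<lambda>a b. Delta \<one> (\<lambda>c d. T a (b \<bullet> c) d))"
  using fun_cong[OF comult_one_1, of T] Delta_coassoc[OF assms one_closed] assms
  by (simp add: sweedler_eval tensor3_def)

lemma Delta_one_2:
  assumes "tri T"
  shows "Delta \<one> (\<lambda>a b. Delta b (\<lambda>c d. T a c d)) = Delta \<one> (\<lambda>c d. Delta \<one> (\<lambda>a b. T a (c \<bullet> b) d))"
  using fun_cong[OF comult_one_2, of T] Delta_coassoc[OF assms one_closed] assms
  by (simp add: sweedler_eval tensor3_def)

section \<open>Left integrals and the antipode\<close>

text \<open>This is \<open>\<epsilon>\<^sub>s(h\<^sub>1) \<otimes> h\<^sub>2 = 1\<^sub>1 \<otimes> h1\<^sub>2\<close>. By \<open>\<Delta>(h) = \<Delta>(h1)\<close> the left-hand side is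
  \<open>1\<^sub>1 \<otimes> \<epsilon>(h\<^sub>1 1'\<^sub>1 1\<^sub>2) h\<^sub>2 1'\<^sub>2\<close>; the weak comultiplicativity of the unit collapses the two copies of
  \<open>\<Delta>(1)\<close> to \<open>1\<^sub>1 \<otimes> \<epsilon>(h\<^sub>1 1\<^sub>2) h\<^sub>2 1\<^sub>3\<close>, to which the counit law for \<open>h1\<^sub>2\<close> applies.\<close>

lemma eps_s_Delta:
  assumes B: "bil B" and h: "h \<in> carr"
  shows "Delta h (\<lambda>x y. B (eps_s H x) y) = Delta \<one> (\<lambda>a b. B a (h \<bullet> b))"
proof -
  note [simp] = bilD[OF B]
  have linB1: "lin (\<lambda>x. B x y)" if "y \<in> carr" for y
    using that by (intro linear_map_onI) auto
  have linB2: "lin (B y)" if "y \<in> carr" for y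
    using that by (intro linear_map_onI) auto
  have tri1: "tri (\<lambda>a c d. \<epsilon> (x \<bullet> c) * B a (y \<bullet> d))" if "x \<in> carr" "y \<in> carr" for x y
    using that by (intro triI bilI) (auto simp: algebra_simps)
  have bil1: "bil (\<lambda>x y. Delta \<one> (\<lambda>a b. \<epsilon> (x \<bullet> b) * B a y))"
    by (intro bilI) (auto simp: algebra_simps sweedler_add sweedler_mult_left)
  have bil2: "bil (\<lambda>u v. \<epsilon> u * B a v)" if "a \<in> carr" for a
    using that by (intro bilI) (auto simp: algebra_simps)
  have "Delta h (\<lambda>x y. B (eps_s H x) y) = Delta h (\<lambda>x y. Delta \<one> (\<lambda>a b. \<epsilon> (x \<bullet> b) * B a y))"
    using h by (simp add: eps_s_def Delta_linear[OF linB1])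
  also have "\<dots> = Delta h (\<lambda>x y. Delta \<one> (\<lambda>c d. Delta \<one> (\<lambda>a b. \<epsilon> (x \<bullet> (c \<bullet> b)) * B a (y \<bullet> d))))"
    using Delta_mult[OF bil1 h one_closed] h by (simp add: mult_assoc)
  also have "\<dots> = Delta h (\<lambda>x y. Delta \<one> (\<lambda>a b. Delta b (\<lambda>c d. \<epsilon> (x \<bullet> c) * B a (y \<bullet> d))))"
    using h by (simp add: Delta_one_2[OF tri1])
  also have "\<dots> = Delta \<one> (\<lambda>a b. Delta h (\<lambda>x y. Delta b (\<lambda>c d. \<epsilon> (x \<bullet> c) * B a (y \<bullet> d))))"
    by (rule sweedler_swap)
  also have "\<dots> = Delta \<one> (\<lambda>a b. Delta (h \<bullet> b) (\<lambda>u v. \<epsilon> u * B a v))"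
    using h by (simp add: Delta_mult[OF bil2])
  also have "\<dots> = Delta \<one> (\<lambda>a b. B a (Delta (h \<bullet> b) (\<lambda>u v. \<epsilon> u \<odot> v)))"
    using h by (simp add: Delta_linear[OF linB2])
  also have "\<dots> = Delta \<one> (\<lambda>a b. B a (h \<bullet> b))"
    using h by (simp add: counit_left)
  finally show ?thesis .
qed

text \<open>The image of \<open>\<epsilon>\<^sub>t\<close> passes through \<open>\<Delta>\<close> on the left: from
  \<open>1\<^sub>1 \<otimes> 1\<^sub>2 \<otimes> 1\<^sub>3 = 1\<^sub>1 \<otimes> 1\<^sub>2 1'\<^sub>1 \<otimes> 1'\<^sub>2\<close> one gets \<open>\<Delta>(z) = z1\<^sub>1 \<otimes> 1\<^sub>2\<close> for \<open>z = \<epsilon>\<^sub>t(x)\<close>,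
  and multiplying by \<open>\<Delta>(l)\<close> absorbs the unit.\<close>

lemma Delta_eps_t_mult:
  assumes B: "bil B" and x: "x \<in> carr" and l: "l \<in> carr"
  shows "Delta (eps_t H x \<bullet> l) B = Delta l (\<lambda>a b. B (eps_t H x \<bullet> a) b)"
proof -
  have step: "Delta (eps_t H x) B = Delta \<one> (\<lambda>c d. B (eps_t H x \<bullet> c) d)" if B: "bil B" for B
  proof -
    note [simp] = bilD[OF B]
    have lin1: "lin (\<lambda>z. Delta z B)"
      using Delta_additive[OF B] Delta_scale[OF B] by (intro linear_map_onI) auto
    have tri1: "tri (\<lambda>a c d. \<epsilon> (a \<bullet> x) * B c d)"
      using x by (intro triI bilI) (auto simp: algebra_simps)
    have lin2: "lin (\<lambda>z. B (z \<bullet> c) d)" if "c \<in> carr" "d \<in> carr" for c d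
      using that by (intro linear_map_onI) auto
    have "Delta (eps_t H x) B = Delta \<one> (\<lambda>a b. Delta (\<epsilon> (a \<bullet> x) \<odot> b) B)"
      unfolding eps_t_def by (intro Delta_linear[OF lin1]) auto
    also have "\<dots> = Delta \<one> (\<lambda>a b. Delta b (\<lambda>c d. \<epsilon> (a \<bullet> x) * B c d))"
      by (simp add: Delta_scale[OF B] sweedler_mult_left)
    also have "\<dots> = Delta \<one> (\<lambda>c d. Delta \<one> (\<lambda>a b. \<epsilon> (a \<bullet> x) * B (b \<bullet> c) d))"
      unfolding Delta_one_1[OF tri1] by (rule sweedler_swap)
    also have "\<dots> = Delta \<one> (\<lambda>c d. B (eps_t H x \<bullet> c) d)"
      using x by (simp add: eps_t_def Delta_linear[OF lin2])
    finally show ?thesis .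
  qed
  note [simp] = bilD[OF B]
  have bil1: "bil (\<lambda>a b. Delta l (\<lambda>c d. B (a \<bullet> c) (b \<bullet> d)))"
    using l by (intro bilI) (auto simp: sweedler_add sweedler_mult_left)
  have bil2: "bil (\<lambda>c d. B (eps_t H x \<bullet> c) d)"
    using x by (intro bilI) auto
  show ?thesis
    using Delta_mult[OF bil2 one_closed l] x l by (simp add: Delta_mult[OF B] step[OF bil1] mult_assoc)
qed

text \<open>The identity \<open>S(h) = S(h\<^sub>1) \<epsilon>\<^sub>t(h\<^sub>2)\<close>, obtained from \<open>S(h) = S(h\<^sub>1) h\<^sub>2 S(h\<^sub>3)\<close> by bracketing the
  last two factors.\<close>

lemma antipode_eps_t:
  assumes F: "lin F" and h: "h \<in> carr"
  shows "F (\<S> h) = Delta h (\<lambda>x y. F (\<S> x \<bullet> eps_t H y))"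
proof -
  note [simp] = linD[OF F]
  have tri1: "tri (\<lambda>c d b. F (\<S> c \<bullet> d \<bullet> \<S> b))"
    by (intro triI bilI) auto
  have lin1: "lin (\<lambda>z. F (\<S> x \<bullet> z))" if "x \<in> carr" for x
    using that by (intro linear_map_onI) auto
  have "F (\<S> h) = F (Delta h (\<lambda>a b. Delta a (\<lambda>c d. \<S> c \<bullet> d \<bullet> \<S> b)))"
    using antipode_antipode[OF h] by simp
  also have "\<dots> = Delta h (\<lambda>a b. Delta a (\<lambda>c d. F (\<S> c \<bullet> d \<bullet> \<S> b)))"
    using h by (simp add: Delta_linear[OF F] sweedler_closed comult_closed)
  also have "\<dots> = Delta h (\<lambda>a b. Delta b (\<lambda>c d. F (\<S> a \<bullet> c \<bullet> \<S> d)))"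
    by (rule Delta_coassoc[OF tri1 h])
  also have "\<dots> = Delta h (\<lambda>x y. F (\<S> x \<bullet> eps_t H y))"
    using h by (simp add: antipode_right[symmetric] Delta_linear[OF lin1] mult_assoc)
  finally show ?thesis .
qed

text \<open>The two computations of \<open>S(h\<^sub>1)(h\<^sub>2l)\<^sub>1 \<otimes> (h\<^sub>2l)\<^sub>2\<close>. In an ordinary Hopf algebra \<open>h\<^sub>2 l = \<epsilon>(h\<^sub>2) l\<close> makes
  this immediate; here the target counital map takes the place of the counit, and the factor
  \<open>\<epsilon>\<^sub>t(h\<^sub>2)\<close> is absorbed by the antipode.\<close>

lemma left_integral_antipode:
  assumes B: "bil B" and h: "h \<in> carr" and l: "l \<in> left_integrals H"
  shows "Delta l (\<lambda>a b. B a (h \<bullet> b)) = Delta l (\<lambda>a b. B (\<S> h \<bullet> a) b)"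
proof -
  note [simp] = bilD[OF B]
  have lc: "l \<in> carr" and li: "\<And>h. h \<in> carr \<Longrightarrow> h \<bullet> l = eps_t H h \<bullet> l"
    using l by (auto simp: left_integrals_def)
  \<comment> \<open>Since \<open>\<Delta>(l) = \<Delta>(1)\<Delta>(l)\<close>, evaluating \<open>B\<close> at \<open>(x \<otimes> y) \<Delta>(l)\<close> reduces the claim to one about \<open>\<Delta>(1)\<close>.\<close>
  define B' where "B' = (\<lambda>x y. Delta l (\<lambda>a b. B (x \<bullet> a) (y \<bullet> b)))"
  have B': "bil B'"
    using lc unfolding B'_def by (intro bilI) (auto simp: sweedler_add sweedler_mult_left)
  note [simp] = bilD[OF B']
  have lin1: "lin (\<lambda>x. B' x y)" if "y \<in> carr" for y
    using that by (intro linear_map_onI) auto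
  have lin2: "lin (\<lambda>x. B (x \<bullet> a) b)" if "a \<in> carr" "b \<in> carr" for a b
    using that by (intro linear_map_onI) auto
  have tri1: "tri (\<lambda>u v y. B' (\<S> u \<bullet> v) y)"
    by (intro triI bilI) auto
  have bil1: "bil (\<lambda>a b. B a (h \<bullet> b))"
    using h by (intro bilI) auto
  have bil2: "bil (\<lambda>a b. B (\<S> x \<bullet> a) b)" if "x \<in> carr" for x
    using that by (intro bilI) auto
  have absorb: "Delta (y \<bullet> l) (\<lambda>a b. B (\<S> x \<bullet> a) b) =
      Delta l (\<lambda>a b. B (\<S> x \<bullet> eps_t H y \<bullet> a) b)" if "x \<in> carr" "y \<in> carr" for x y
    unfolding li[OF that(2)] Delta_eps_t_mult[OF bil2[OF that(1)] that(2) lc]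
    using that lc by (simp add: mult_assoc)
  have "Delta l (\<lambda>a b. B a (h \<bullet> b)) = Delta \<one> (\<lambda>x y. B' x (h \<bullet> y))"
    using Delta_mult[OF bil1 one_closed lc] lc h by (simp add: B'_def mult_assoc)
  also have "\<dots> = Delta h (\<lambda>x y. B' (eps_s H x) y)"
    by (rule eps_s_Delta[OF B' h, symmetric])
  also have "\<dots> = Delta h (\<lambda>x y. Delta x (\<lambda>u v. B' (\<S> u \<bullet> v) y))"
    using h by (simp add: antipode_left[symmetric] Delta_linear[OF lin1])
  also have "\<dots> = Delta h (\<lambda>x y. Delta y (\<lambda>u v. B' (\<S> x \<bullet> u) v))"
    by (rule Delta_coassoc[OF tri1 h])
  also have "\<dots> = Delta h (\<lambda>x y. Delta (y \<bullet> l) (\<lambda>a b. B (\<S> x \<bullet> a) b))"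
    using h lc by (simp add: B'_def Delta_mult[OF bil2] mult_assoc)
  also have "\<dots> = Delta h (\<lambda>x y. Delta l (\<lambda>a b. B (\<S> x \<bullet> eps_t H y \<bullet> a) b))"
    using h by (simp add: absorb)
  also have "\<dots> = Delta l (\<lambda>a b. Delta h (\<lambda>x y. B (\<S> x \<bullet> eps_t H y \<bullet> a) b))"
    by (rule sweedler_swap)
  also have "\<dots> = Delta l (\<lambda>a b. B (\<S> h \<bullet> a) b)"
    using h lc by (simp add: antipode_eps_t[OF lin2])
  finally show ?thesis .
qed

text \<open>Evaluating the second leg of \<open>left_integral_antipode\<close> at \<open>lam\<close> turns its right-hand side into
  \<open>S(h) (lam \<rightharpoonup> l) = S(h)\<close>, so that the dual pair recovers the antipode.\<close>

lemma left_integral_formula_antipode: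
  assumes l: "l \<in> left_integrals H" and lam: "lin lam" and dual: "harpoon H lam l = \<one>"
    and F: "lin F" and h: "h \<in> carr"
  shows "F (\<S> h) = Delta l (\<lambda>a b. lam (h \<bullet> b) * F a)"
proof -
  note [simp] = linD[OF F] linD[OF lam]
  have lc: "l \<in> carr" using l by (simp add: left_integrals_def)
  have bil1: "bil (\<lambda>a b. lam b * F a)"
    by (intro bilI) (auto simp: algebra_simps)
  have lin1: "lin (\<lambda>x. F (\<S> h \<bullet> x))"
    using h by (intro linear_map_onI) auto
  have "Delta l (\<lambda>a b. lam (h \<bullet> b) * F a) = Delta l (\<lambda>a b. F (\<S> h \<bullet> (lam b \<odot> a)))"
    using left_integral_antipode[OF bil1 h l] h lc by simp
  also have "\<dots> = F (\<S> h \<bullet> harpoon H lam l)"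
    unfolding harpoon_def using lc by (intro Delta_linear[OF lin1, symmetric]) auto
  finally show ?thesis using h by (simp add: dual)
qed

text \<open>Taking the functional \<open>F \<circ> S\<close> in \<open>left_integral_formula_antipode\<close> decomposes \<open>S\<^sup>2\<close> into the
  rank-one maps \<open>h \<mapsto> lam(h l\<^sub>2) S(l\<^sub>1)\<close>.\<close>

lemma trace_antipode_square:
  assumes fd: "fin_dim H" and l: "l \<in> left_integrals H" and lam: "lin lam"
    and dual: "harpoon H lam l = \<one>"
  shows "endo_trace H (\<S> \<circ> \<S>) = lam (eps_s H l)"
proof -
  note [simp] = linD[OF lam]
  have lc: "l \<in> carr" using l by (simp add: left_integrals_def)
  have "endo_trace H (\<S> \<circ> \<S>) = Delta l (\<lambda>a b. lam (\<S> a \<bullet> b))"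
  proof (rule endo_trace_sweedler[where G = "\<lambda>a b h. lam (h \<bullet> b)" and u = "\<lambda>a b. \<S> a",
      OF fd comult_closed[OF lc]])
    show "lin (\<lambda>h. lam (h \<bullet> b))" if "b \<in> carr" for b
      using that by (intro linear_map_onI) auto
    show "\<S> a \<in> carr" if "a \<in> carr" for a
      using that by simp
    fix F h assume F: "lin F" and h: "h \<in> carr"
    have "lin (\<lambda>x. F (\<S> x))"
      using linD[OF F] by (intro linear_map_onI) auto
    from left_integral_formula_antipode[OF l lam dual this h]
    show "F ((\<S> \<circ> \<S>) h) = Delta l (\<lambda>a b. lam (h \<bullet> b) * F (\<S> a))"
      by simp
  qed
  also have "\<dots> = lam (eps_s H l)"
    using lc by (simp add: antipode_left[symmetric] Delta_linear[OF lam])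
  finally show ?thesis .
qed

end

section \<open>The source counital map of the dual\<close>

context vec_space
begin

lemma dual_carrier: "\<phi> \<in> vcarrier (dual_space V) \<longleftrightarrow>
    linear_map_on V (*) \<phi> \<and> (\<forall>x. x \<notin> vcarrier V \<longrightarrow> \<phi> x = 0)"
  and dual_scale: "vscale (dual_space V) c \<phi> = (\<lambda>x. c * \<phi> x)"
  by (simp_all add: dual_space_def)

lemma vec_space_dual: "vec_space (dual_space V)"
proof (rule vec_space.intro)
  show "vector_space (vscale (dual_space V))"
    by unfold_locales (auto simp: dual_space_def fun_eq_iff algebra_simps)
  then interpret D: vector_space "vscale (dual_space V)" .
  show "D.subspace (vcarrier (dual_space V))"
    by (auto simp: D.subspace_def dual_carrier dual_scale linear_map_on_def algebra_simps)
qed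

lemma coordinate_in_dual:
  assumes "finite_basis B"
  shows "(\<lambda>x. amb.representation B x b) \<in> vcarrier (dual_space V)"
  using linear_representation[OF assms] assms
  by (auto simp: dual_carrier finite_basis_def amb.representation_def)

lemma finite_basis_dual_expand:
  assumes B: "finite_basis B" and \<phi>: "\<phi> \<in> vcarrier (dual_space V)"
    and F: "linear_map_on (dual_space V) (*) F"
  shows "F \<phi> = (\<Sum>b\<in>B. \<phi> b * F (\<lambda>x. amb.representation B x b))"
proof -
  interpret D: vec_space "dual_space V" by (rule vec_space_dual)
  note coord = coordinate_in_dual[OF B]
  have expand: "\<phi> = (\<Sum>b\<in>B. (\<lambda>x. \<phi> b * amb.representation B x b))"
  proof
    fix x
    show "\<phi> x = (\<Sum>b\<in>B. (\<lambda>x. \<phi> b * amb.representation B x b)) x"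
    proof (cases "x \<in> vcarrier V")
      case True
      then show ?thesis
        using linear_expand[OF B _ True, of \<phi>] \<phi>
        by (simp add: dual_carrier sum_fun_apply mult.commute)
    next
      case False
      then show ?thesis
        using \<phi> B by (simp add: dual_carrier sum_fun_apply finite_basis_def amb.representation_def)
    qed
  qed
  obtain bs where bs: "set bs = B" "distinct bs"
    using B finite_distinct_list unfolding finite_basis_def by blast
  have "(\<Sum>b\<leftarrow>bs. vscale (dual_space V) (\<phi> b) (\<lambda>x. amb.representation B x b)) = \<phi>"
    unfolding dual_scale sum_list_distinct_conv_sum_set[OF bs(2)] bs(1) by (rule expand[symmetric])
  then have "F \<phi> = F (\<Sum>b\<leftarrow>bs. vscale (dual_space V) (\<phi> b) (\<lambda>x. amb.representation B x b))"
    by (rule arg_cong[where f = F, OF sym])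
  also have "\<dots> = (\<Sum>b\<leftarrow>bs. F (vscale (dual_space V) (\<phi> b) (\<lambda>x. amb.representation B x b)))"
    by (intro D.linear_map_on_sum_list[OF F, THEN conjunct1] D.carrier_scale coord)
  also have "\<dots> = (\<Sum>b\<in>B. \<phi> b * F (\<lambda>x. amb.representation B x b))"
    using bs F coord by (simp add: linear_map_on_def sum_list_distinct_conv_sum_set)
  finally show ?thesis .
qed

lemma dual_pairing_bilinear:
  "bilinear_map_on (dual_space V) (*) (\<lambda>\<alpha> \<gamma>. \<alpha> h * \<gamma> g)"
  by (simp add: bilinear_map_on_def linear_map_on_def dual_scale algebra_simps)

text \<open>The coproduct of \<open>dual H\<close> is a definite description. That it denotes the intended tensor rests on the
  isomorphism between the tensor square of the dual and the bilinear forms on a finite-dimensional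
  space: injectivity here, surjectivity in \<open>dual_tensor_exists\<close>. For injectivity, every bilinear form
  on the dual is expanded in coordinates, hence is a combination of the pairings with basis vectors.\<close>

lemma dual_tensor_unique:
  assumes B: "finite_basis B"
    and t: "t \<in> tensor_square (dual_space V)" and u: "u \<in> tensor_square (dual_space V)"
    and eq: "\<And>h g. \<lbrakk>h \<in> vcarrier V; g \<in> vcarrier V\<rbrakk> \<Longrightarrow>
      sweedler (dual_space V) t (\<lambda>\<alpha> \<gamma>. \<alpha> h * \<gamma> g) = sweedler (dual_space V) u (\<lambda>\<alpha> \<gamma>. \<alpha> h * \<gamma> g)"
  shows "t = u"
proof
  fix F :: "('a \<Rightarrow> 'k) \<Rightarrow> ('a \<Rightarrow> 'k) \<Rightarrow> 'k"
  let ?D = "dual_space V" and ?c = "\<lambda>b x. amb.representation B x b"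
  show "t F = u F"
  proof (cases "bilinear_map_on ?D (*) F")
    case True
    note coord = coordinate_in_dual[OF B]
    have "F \<alpha> \<gamma> = (\<Sum>b\<in>B. \<Sum>c\<in>B. \<alpha> b * \<gamma> c * F (?c b) (?c c))"
      if \<alpha>: "\<alpha> \<in> vcarrier ?D" and \<gamma>: "\<gamma> \<in> vcarrier ?D" for \<alpha> \<gamma>
      using finite_basis_dual_expand[OF B \<alpha>, of "\<lambda>\<alpha>. F \<alpha> \<gamma>"]
        finite_basis_dual_expand[OF B \<gamma>, of "F _"] True \<gamma> coord
      by (simp add: bilinear_map_on_def sum_distrib_left mult.assoc)
    then have expand: "s F = (\<Sum>b\<in>B. \<Sum>c\<in>B. sweedler ?D s (\<lambda>\<alpha> \<gamma>. \<alpha> b * \<gamma> c) * F (?c b) (?c c))"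
      if "s \<in> tensor_square ?D" for s
      unfolding sweedler_bilinear[OF that True, symmetric] sweedler_mult_right[symmetric]
        sweedler_sum[symmetric]
      by (rule sweedler_cong[OF that])
    show ?thesis
      unfolding expand[OF t] expand[OF u] using eq finite_basis_in[OF B] by simp
  next
    case False
    \<comment> \<open>Tensors are functionals on all functions of two arguments, with value 0 off the bilinear forms.\<close>
    then have zero: "(\<Sum>(\<alpha>, \<gamma>)\<leftarrow>ps. tensor2 ?D \<alpha> \<gamma>) F = 0" for ps
      by (induction ps) (auto simp: tensor2_def)
    have "s F = 0" if "s \<in> tensor_square ?D" for s
      using that zero by (auto simp: tensor_square_def tensor_reps_def)
    from this[OF t] this[OF u] show ?thesis by simp
  qed
qed

text \<open>The form \<open>\<beta>\<close> is represented by the sum of \<open>b\<^sup>* \<otimes> \<beta>(b, -)\<close> over a basis.\<close>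

lemma dual_tensor_exists:
  assumes B: "finite_basis B" and \<beta>: "bilinear_map_on V (*) \<beta>"
  obtains t where "t \<in> tensor_square (dual_space V)"
    and "\<And>h g. \<lbrakk>h \<in> vcarrier V; g \<in> vcarrier V\<rbrakk> \<Longrightarrow>
      sweedler (dual_space V) t (\<lambda>\<alpha> \<gamma>. \<alpha> h * \<gamma> g) = \<beta> h g"
proof -
  let ?D = "dual_space V"
  obtain bs where bs: "set bs = B" "distinct bs"
    using B finite_distinct_list unfolding finite_basis_def by blast
  define ps where "ps = map (\<lambda>b. (\<lambda>x. amb.representation B x b,
    \<lambda>x. if x \<in> vcarrier V then \<beta> b x else 0)) bs"
  define t where "t = (\<Sum>(a, b)\<leftarrow>ps. tensor2 ?D a b)"
  have "set ps \<subseteq> vcarrier ?D \<times> vcarrier ?D"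
    using coordinate_in_dual[OF B] \<beta> bs finite_basis_in[OF B]
    by (auto simp: ps_def dual_carrier bilinear_map_on_def linear_map_on_def)
  then have ps: "ps \<in> tensor_reps ?D t"
    by (simp add: tensor_reps_def t_def)
  then have t: "t \<in> tensor_square ?D"
    by (auto simp: tensor_square_def)
  have "sweedler ?D t (\<lambda>\<alpha> \<gamma>. \<alpha> h * \<gamma> g) = \<beta> h g"
    if "h \<in> vcarrier V" "g \<in> vcarrier V" for h g
  proof -
    have "sweedler ?D t (\<lambda>\<alpha> \<gamma>. \<alpha> h * \<gamma> g) = (\<Sum>(\<alpha>, \<gamma>)\<leftarrow>ps. \<alpha> h * \<gamma> g)"
      using sweedler_bilinear[OF t dual_pairing_bilinear]
        tensor_rep_eval[OF ps dual_pairing_bilinear] by simp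
    also have "\<dots> = (\<Sum>b\<in>B. amb.representation B h b * \<beta> b g)"
      using bs that by (simp add: ps_def o_def sum_list_distinct_conv_sum_set)
    also have "\<dots> = \<beta> h g"
      using linear_expand[OF B, of "\<lambda>x. \<beta> x g" h] \<beta> that by (simp add: bilinear_map_on_def)
    finally show ?thesis .
  qed
  with t show ?thesis by (rule that)
qed

end

context weak_hopf_algebra
begin

lemma dual_comult_counit:
  assumes "fin_dim H"
  defines "t \<equiv> hcomult (dual H) (hone (dual H))"
  shows "t \<in> tensor_square (dual_space H)"
    and "\<And>h g. \<lbrakk>h \<in> carr; g \<in> carr\<rbrakk> \<Longrightarrow> sweedler (dual_space H) t (\<lambda>\<alpha> \<gamma>. \<alpha> h * \<gamma> g) = \<epsilon> (h \<bullet> g)"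
proof -
  let ?P = "\<lambda>t. t \<in> tensor_square (dual_space H) \<and>
    (\<forall>h\<in>carr. \<forall>g\<in>carr. sweedler (dual_space H) t (\<lambda>\<alpha> \<gamma>. \<alpha> h * \<gamma> g) = hone (dual H) (h \<bullet> g))"
  obtain B where B: "finite_basis B"
    by (rule endo_trace_basis[OF assms(1)])
  have one: "hone (dual H) (h \<bullet> g) = \<epsilon> (h \<bullet> g)" if "h \<in> carr" "g \<in> carr" for h g
    using that by (simp add: dual_def)
  have "bil (\<lambda>h g. \<epsilon> (h \<bullet> g))"
    by (intro bilI) auto
  then obtain u where u: "?P u"
    using dual_tensor_exists[OF B] one by metis
  have "s = u" if "?P s" for s
    using that u by (intro dual_tensor_unique[OF B]) auto
  with u have "?P (THE t. ?P t)" by (rule theI)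
  then have "?P t" unfolding t_def dual_def by simp
  then show "t \<in> tensor_square (dual_space H)"
    and "\<And>h g. \<lbrakk>h \<in> carr; g \<in> carr\<rbrakk> \<Longrightarrow> sweedler (dual_space H) t (\<lambda>\<alpha> \<gamma>. \<alpha> h * \<gamma> g) = \<epsilon> (h \<bullet> g)"
    using one by auto
qed

text \<open>The counit of the dual evaluates at \<open>1\<close>, so \<open>\<epsilon>\<^sub>s(lam) = \<epsilon>\<^sub>1 \<langle>lam \<epsilon>\<^sub>2, 1\<rangle>\<close> with Sweedler components
  of \<open>\<Delta>(\<epsilon>)\<close>. Expanding the product in the dual gives \<open>\<epsilon>\<^sub>1(z) lam(1\<^sub>1) \<epsilon>\<^sub>2(1\<^sub>2)\<close>, and
  \<open>\<epsilon>\<^sub>1(z) \<epsilon>\<^sub>2(b) = \<epsilon>(zb)\<close>.\<close>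

lemma dual_eps_s:
  assumes fd: "fin_dim H" and lam: "lin lam" and z: "z \<in> carr"
  shows "eps_s (dual H) lam z = Delta \<one> (\<lambda>a b. lam a * \<epsilon> (z \<bullet> b))"
proof -
  let ?t = "hcomult (dual H) (hone (dual H))"
  \<comment> \<open>Tensors depend only on the vector space structure, which \<open>dual H\<close> shares with \<open>dual_space H\<close>.\<close>
  have reps: "tensor_reps (dual H) s = tensor_reps (dual_space H) s" for s
    by (simp add: tensor_reps_def dual_def tensor2_def bilinear_map_on_def linear_map_on_def)
  have "eps_s (dual H) lam z =
      sweedler (dual_space H) ?t (\<lambda>\<alpha> \<gamma>. Delta \<one> (\<lambda>a b. lam a * (\<alpha> z * \<gamma> b)))"
    unfolding eps_s_def sweedler_eval sweedler_def[of "dual H"] reps sweedler_def[of "dual_space H", symmetric]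
    by (simp add: dual_def dual_scale sweedler_mult_left[symmetric] sweedler_mult_right[symmetric] mult_ac)
  also have "\<dots> = Delta \<one> (\<lambda>a b. lam a * sweedler (dual_space H) ?t (\<lambda>\<alpha> \<gamma>. \<alpha> z * \<gamma> b))"
    by (subst sweedler_swap) (simp add: sweedler_mult_left)
  finally show ?thesis
    using z by (simp add: dual_comult_counit(2)[OF fd])
qed

text \<open>This is the second form of the weak multiplicativity of the counit, read at the unit:
  \<open>\<epsilon>(x 1 y) = \<epsilon>(x 1\<^sub>2) \<epsilon>(1\<^sub>1 y)\<close>.\<close>

lemma counit_eps_s_mult:
  assumes "x \<in> carr" "y \<in> carr"
  shows "\<epsilon> (eps_s H x \<bullet> y) = \<epsilon> (x \<bullet> y)"
proof -
  have lin1: "lin (\<lambda>z. \<epsilon> (z \<bullet> y))"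
    using assms by (intro linear_map_onI) auto
  have "\<epsilon> (eps_s H x \<bullet> y) = Delta \<one> (\<lambda>a b. \<epsilon> (x \<bullet> b) * \<epsilon> (a \<bullet> y))"
    using assms by (simp add: eps_s_def Delta_linear[OF lin1])
  also have "\<dots> = \<epsilon> (x \<bullet> y)"
    using counit_mult_2[of x \<one> y] assms by simp
  finally show ?thesis .
qed

lemma dual_eps_s_eps_s:
  assumes fd: "fin_dim H" and lam: "lin lam" and x: "x \<in> carr"
  shows "eps_s (dual H) lam (eps_s H x) = lam (eps_s H x)"
proof -
  note [simp] = linD[OF lam]
  have "eps_s (dual H) lam (eps_s H x) = Delta \<one> (\<lambda>a b. lam (\<epsilon> (x \<bullet> b) \<odot> a))"
    using x by (simp add: dual_eps_s[OF fd lam] counit_eps_s_mult mult.commute)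
  also have "\<dots> = lam (eps_s H x)"
    unfolding eps_s_def using x by (intro Delta_linear[OF lam, symmetric]) auto
  finally show ?thesis .
qed

end

theorem proposition6p1:
  fixes H :: "('k::{alg_closed_field, field_char_0}, 'a::ab_group_add) weak_hopf_data"
    and l :: 'a and lam :: "'a \<Rightarrow> 'k"
  assumes "weak_hopf_algebra H"
    and "fin_dim H"
    and "frobenius_algebra H"
    and "l \<in> left_integrals H"
    and "nondegenerate_element H l"
    and "lam \<in> left_integrals (dual H)"
    and "harpoon H lam l = hone H"
    and "harpoon (dual H) (\<lambda>\<phi>. \<phi> l) lam = hone (dual H)"
  shows "endo_trace H (hantipode H \<circ> hantipode H) = eps_s (dual H) lam (eps_s H l)"
proof -
  interpret weak_hopf_algebra H by fact
  have lam: "lin lam"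
    using assms(6) by (simp add: left_integrals_def dual_def dual_carrier)
  have "l \<in> carr"
    using assms(4) by (simp add: left_integrals_def)
  then show ?thesis
    using trace_antipode_square[OF assms(2,4) lam assms(7)] dual_eps_s_eps_s[OF assms(2) lam]
    by simp
qed

end
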